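(* Let $n\in\mathbb{N}$, and let $S\subseteq\mathbb{R}^n$ be a subset. Then the following are equivalent: (i) the graph $\mathrm{Sch}(\mathbb{R}^n,S,\mathbb{R}^n)$ admits a domatic $\aleph_0$-partition with open parts; (ii) $\mathrm{Sch}(\mathbb{R}^n,S,\mathbb{R}^n)$ admits a domatic $\aleph_0$-partition with Baire measurable parts; (iii) either the topological closure $\overline{S}\subseteq\mathbb{R}^n$ is uncountable or $S\subseteq\mathbb{R}^n$ is unbounded.
   Context: The Schreier graph $\mathrm{Sch}(\mathbb{R}^n,S,\mathbb{R}^n)$ is the directed graph (loops allowed) with vertex set $\mathbb{R}^n$ and edge set $\{(x,s+x):x\in\mathbb{R}^n,\ s\in S\}$, so the out-neighborhood of $x$ is $S+x$. A domatic $\aleph_0$-partition of this graph is a sequence $\langle D_j:j\in\mathbb{N}\rangle$ of pairwise-disjoint subsets of $\mathbb{R}^n$ (not required to cover $\mathbb{R}^n$) such that $(S+x)\cap D_j\neq\varnothing$ for every $x\in\mathbb{R}^n$ and $j\in\mathbb{N}$. The sets $D_j$ are its parts. A set is Baire measurable if it has the Baire property. $\mathbb{N}=\{0,1,2,\ldots\}$. *)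

theory Defs
  imports "HOL-Analysis.Analysis" "Graph_Theory.Pair_Digraph"
begin

text \<open>The space R^n, for a natural number n that may be 0, is the topology \<^term>\<open>Euclidean_space n\<close>:
  its points are the functions \<^typ>\<open>nat \<Rightarrow> real\<close> that vanish from index n on.\<close>

abbreviation Rn :: "nat \<Rightarrow> (nat \<Rightarrow> real) set" where
  "Rn n \<equiv> topspace (Euclidean_space n)"

definition euclid_dist :: "nat \<Rightarrow> (nat \<Rightarrow> real) \<Rightarrow> (nat \<Rightarrow> real) \<Rightarrow> real" where
  "euclid_dist n x y = L2_set (\<lambda>i. x i - y i) {..<n}"

lemma Metric_space_euclid_dist: "Metric_space (Rn n) (euclid_dist n)"
proof
  fix x y z :: "nat \<Rightarrow> real"
  show "0 \<le> euclid_dist n x y"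
    by (simp add: euclid_dist_def)
  show "euclid_dist n x y = euclid_dist n y x"
    by (simp add: euclid_dist_def L2_set_def power2_commute)
  show "euclid_dist n x y = 0 \<longleftrightarrow> x = y" if "x \<in> Rn n" "y \<in> Rn n"
  proof -
    have "x = y" if "\<forall>i<n. x i = y i"
    proof
      fix i show "x i = y i"
        using \<open>x \<in> Rn n\<close> \<open>y \<in> Rn n\<close> that by (cases "i < n") (auto simp: topspace_Euclidean_space)
    qed
    then show ?thesis
      by (auto simp: euclid_dist_def L2_set_eq_0_iff)
  qed
  show "euclid_dist n x z \<le> euclid_dist n x y + euclid_dist n y z"
    using L2_set_triangle_ineq[of "\<lambda>i. x i - y i" "\<lambda>i. y i - z i" "{..<n}"]
    by (simp add: euclid_dist_def)
qed

definition Rn_bounded :: "nat \<Rightarrow> (nat \<Rightarrow> real) set \<Rightarrow> bool" where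
  "Rn_bounded n S \<longleftrightarrow> Metric_space.mbounded (Rn n) (euclid_dist n) S"

definition Sch :: "nat \<Rightarrow> (nat \<Rightarrow> real) set \<Rightarrow> (nat \<Rightarrow> real) pair_pre_digraph" where
  "Sch n S = \<lparr> pverts = Rn n, parcs = {(x, \<lambda>i. s i + x i) | x s. x \<in> Rn n \<and> s \<in> S} \<rparr>"

text \<open>The out-neighborhood of a vertex x is the relational image \<^term>\<open>parcs G `` {x}\<close>.
  The parts need not cover the vertex set.\<close>

definition domatic_partition :: "'a pair_pre_digraph \<Rightarrow> (nat \<Rightarrow> 'a set) \<Rightarrow> bool" where
  "domatic_partition G D \<longleftrightarrow>
     (\<forall>j. D j \<subseteq> pverts G) \<and> disjoint_family D \<and>
     (\<forall>x\<in>pverts G. \<forall>j. parcs G `` {x} \<inter> D j \<noteq> {})"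

definition nowhere_dense_in :: "'a topology \<Rightarrow> 'a set \<Rightarrow> bool" where
  "nowhere_dense_in X N \<longleftrightarrow> N \<subseteq> topspace X \<and> X interior_of (X closure_of N) = {}"

definition meager_in :: "'a topology \<Rightarrow> 'a set \<Rightarrow> bool" where
  "meager_in X M \<longleftrightarrow> (\<exists>N :: nat \<Rightarrow> 'a set. (\<forall>k. nowhere_dense_in X (N k)) \<and> M = (\<Union>k. N k))"

definition Baire_measurable_in :: "'a topology \<Rightarrow> 'a set \<Rightarrow> bool" where
  "Baire_measurable_in X A \<longleftrightarrow>
     A \<subseteq> topspace X \<and> (\<exists>U. openin X U \<and> meager_in X (sym_diff A U))"

end

(* If S is bounded with countable closure K and the parts agree with open sets U_j up to meager sets,
   then a Baire-generic x has K + x disjoint from all these meager sets and from the frontier of the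
   union of the U_j. So the compact set K + x is covered by the U_j and the interior of the complement
   of their union; a finite subcover involves only finitely many j, yet K + x meets every D_j.

   Conversely, S has an unbounded coordinate projection, or its closure has an uncountable one, and
   open parts can be pulled back from the real line. For an unbounded set of reals, take unions of
   longer and longer intervals centred at a sparse sequence of its points. For an uncountable set K
   choose frequencies u_0, u_1, ... such that (u_i s mod 1)_{i<j} comes close to every point of the
   j-torus as s ranges over K (Kronecker's theorem, applied to rationally independent condensation
   points); then take E_j to be the set of y with u_i y mod 1 in (0,1/2) for i < j and u_j y mod 1
   in (1/2,1). *)

theory Submission
  imports Defs
begin

section \<open>Condensation points and rationally independent reals\<close>

text \<open>A point of \<open>X\<close> that is not a condensation point lies in an open set meeting
  \<open>X\<close> in a countable set. By Lindelof countably many such open sets cover all these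
  points, so only countably many points of \<open>X\<close> are lost.\<close>

lemma uncountable_condensation_points:
  fixes X :: "'a::second_countable_topology set"
  assumes "uncountable X"
  shows "uncountable {x \<in> X. \<forall>U. open U \<longrightarrow> x \<in> U \<longrightarrow> uncountable (X \<inter> U)}"
proof
  assume *: "countable {x \<in> X. \<forall>U. open U \<longrightarrow> x \<in> U \<longrightarrow> uncountable (X \<inter> U)}"
  define F where "F = {U. open U \<and> countable (X \<inter> U)}"
  obtain F' where F': "F' \<subseteq> F" "countable F'" "\<Union>F' = \<Union>F"
    using Lindelof[of F] unfolding F_def by blast
  have "countable (\<Union>U\<in>F'. X \<inter> U)"
    using F' by (intro countable_UN) (auto simp: F_def)
  also have "(\<Union>U\<in>F'. X \<inter> U) = X \<inter> \<Union>F"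
    using F'(3) by blast
  finally have "countable (X \<inter> \<Union>F)" .
  with * have "countable ({x \<in> X. \<forall>U. open U \<longrightarrow> x \<in> U \<longrightarrow> uncountable (X \<inter> U)} \<union> (X \<inter> \<Union>F))"
    by (rule countable_Un)
  then have "countable X"
    by (rule countable_subset[rotated]) (auto simp: F_def)
  with assms show False
    by simp
qed

lemma vector_space_rat_real: "vector_space (\<lambda>r x. of_rat r * x :: real)"
  by unfold_locales (auto simp: algebra_simps of_rat_add of_rat_mult)

text \<open>A new generator \<open>b\<close> replaces the span by the union of its translates by
  rational multiples of \<open>b\<close>, and there are only countably many of these.\<close>

lemma countable_rat_span:
  fixes B :: "real set"
  assumes "finite B"
  shows "countable (module.span (\<lambda>r x. of_rat r * x) B)"
proof -
  interpret Q: vector_space "\<lambda>r x. of_rat r * x :: real"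
    by (rule vector_space_rat_real)
  show ?thesis
    using assms
  proof induction
    case (insert b B)
    have "Q.span (insert b B) \<subseteq> (\<Union>k. (\<lambda>y. y + of_rat k * b) ` Q.span B)"
    proof
      fix x assume "x \<in> Q.span (insert b B)"
      then obtain k where "x - of_rat k * b \<in> Q.span B"
        by (auto simp: Q.span_insert)
      then show "x \<in> (\<Union>k. (\<lambda>y. y + of_rat k * b) ` Q.span B)"
        by (auto intro!: exI[of _ k] image_eqI[of _ _ "x - of_rat k * b"])
    qed
    moreover have "countable (\<Union>k. (\<lambda>y. y + of_rat k * b) ` Q.span B)"
      using insert.IH by (intro countable_UN) auto
    ultimately show ?case
      by (rule countable_subset)
  qed simp
qed

text \<open>The points are chosen greedily: the rational span of those already chosen is countable,
  so the next uncountable set has a point outside it. Injectivity is recorded separately because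
  independence of the image set does not detect repetitions.\<close>

lemma rat_independent_selection:
  fixes C :: "nat \<Rightarrow> real set"
  assumes "\<And>i. i < N \<Longrightarrow> uncountable (C i)"
  shows "\<exists>\<theta>. (\<forall>i<N. \<theta> i \<in> C i) \<and> inj_on \<theta> {..<N} \<and>
           \<not> module.dependent (\<lambda>r x. of_rat r * x) (\<theta> ` {..<N})"
proof -
  interpret Q: vector_space "\<lambda>r x. of_rat r * x :: real"
    by (rule vector_space_rat_real)
  show ?thesis
    using assms
  proof (induction N)
    case 0
    then show ?case by (simp add: Q.independent_empty)
  next
    case (Suc N)
    then obtain \<theta> where \<theta>: "\<forall>i<N. \<theta> i \<in> C i" "inj_on \<theta> {..<N}" "Q.independent (\<theta> ` {..<N})"
      by auto
    have "countable (Q.span (\<theta> ` {..<N}))"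
      by (rule countable_rat_span) simp
    then have "\<not> C N \<subseteq> Q.span (\<theta> ` {..<N})"
      using Suc.prems[of N] countable_subset[of "C N"] by (meson lessI)
    then obtain y where y: "y \<in> C N" "y \<notin> Q.span (\<theta> ` {..<N})"
      by (meson subsetI)
    then have "y \<notin> \<theta> ` {..<N}"
      using Q.span_base[of y "\<theta> ` {..<N}"] by metis
    have im: "(\<theta>(N := y)) ` {..<Suc N} = insert y (\<theta> ` {..<N})"
      by (auto simp: lessThan_Suc)
    have "inj_on (\<theta>(N := y)) {..<Suc N}"
      using \<theta>(2) \<open>y \<notin> \<theta> ` {..<N}\<close> by (auto simp: lessThan_Suc inj_on_def)
    moreover have "Q.independent ((\<theta>(N := y)) ` {..<Suc N})"
      unfolding im by (rule Q.independent_insertI[OF y(2) \<theta>(3)])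
    moreover have "\<forall>i<Suc N. (\<theta>(N := y)) i \<in> C i"
      using \<theta>(1) y(1) by (simp add: less_Suc_eq)
    ultimately show ?case
      by blast
  qed
qed

text \<open>Kronecker's theorem is stated for independence over the integers; an integer relation is
  in particular a rational one.\<close>

lemma rat_independent_imp_int_independent:
  fixes B :: "real set"
  assumes "\<not> module.dependent (\<lambda>r x. of_rat r * x) B"
  shows "\<not> module.dependent (\<lambda>r. (*) (real_of_int r)) B"
proof -
  interpret Q: vector_space "\<lambda>r x. of_rat r * x :: real"
    by (rule vector_space_rat_real)
  interpret Z: Modules.module "\<lambda>r. (*) (real_of_int r)"
    by (simp add: Modules.module.intro distrib_left mult.commute)
  show ?thesis
  proof
    assume "Z.dependent B"
    then obtain t u v where t: "finite t" "t \<subseteq> B" "(\<Sum>v\<in>t. real_of_int (u v) * v) = 0" "v \<in> t" "u v \<noteq> 0"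
      unfolding Z.dependent_explicit by blast
    have "(\<Sum>v\<in>t. of_rat (of_int (u v)) * v) = 0"
      using t(3) by simp
    from Q.independentD[OF assms t(1,2) this t(4)] t(5) show False
      by simp
  qed
qed

section \<open>Approximation modulo 1 and the choice of frequencies\<close>

text \<open>This is the preimage in the line of an open arc of the circle R/Z with centre
  \<open>t\<close> and radius \<open>\<epsilon>\<close>. The explicit integer \<open>m\<close>
  avoids a case distinction where fractional parts wrap around.\<close>

definition near_mod1 :: "real \<Rightarrow> real \<Rightarrow> real set" where
  "near_mod1 \<epsilon> t = {y. \<exists>m::int. \<bar>y - t - m\<bar> < \<epsilon>}"

lemma open_near_mod1: "open (near_mod1 \<epsilon> t)"
proof -
  have "near_mod1 \<epsilon> t = (\<Union>m::int. ball (t + m) \<epsilon>)"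
    by (auto simp: near_mod1_def dist_real_def abs_minus_commute algebra_simps)
  then show ?thesis
    by (simp only:) (intro open_UN ballI open_ball)
qed

lemma open_scaled_near_mod1: "open {y. u * y \<in> near_mod1 \<epsilon> t}"
  using open_vimage[OF open_near_mod1, of "\<lambda>y. u * y"] by (auto simp: vimage_def intro!: continuous_intros)

text \<open>Modulo 1 these are the arcs (0,1/2) and (1/2,1). A common point would give integers with
  0 < \<open>m - k\<close> < 1.\<close>

lemma near_mod1_disjoint: "near_mod1 (1/4) (1/4) \<inter> near_mod1 (1/4) (3/4) = {}"
proof -
  have False if "\<bar>y - 1/4 - real_of_int m\<bar> < 1/4" "\<bar>y - 3/4 - real_of_int k\<bar> < 1/4" for y and m k :: int
  proof -
    have "real_of_int (m - k) < 1" "real_of_int (m - k) > 0"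
      using that by (simp_all add: abs_if split: if_splits)
    then have "m - k < 1" "m - k > 0"
      by (simp_all only: of_int_less_1_iff of_int_0_less_iff)
    then show False
      by linarith
  qed
  then show ?thesis
    by (auto simp: near_mod1_def)
qed

text \<open>A finite net of the circle: every real is within 1/8 of one of these points modulo
  1.\<close>

abbreviation quarters :: "real set" where
  "quarters \<equiv> (\<lambda>k. real_of_int k / 4) ` {0..<4}"

text \<open>Rounding \<open>c - \<alpha>\<close> to the nearest quarter costs at most 1/8, and the
  distance from \<open>y\<close> to \<open>t\<close> modulo 1 is below 1/8. Together this stays
  below 1/4, so finitely many targets handle all shifts \<open>\<alpha>\<close> and all centres
  \<open>c\<close>.\<close>

lemma quarter_translate:
  obtains t where "t \<in> quarters" "\<And>y. y \<in> near_mod1 (1/8) t \<Longrightarrow> y + \<alpha> \<in> near_mod1 (1/4) c"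
proof
  define r where "r = round (4 * (c - \<alpha>))"
  have r: "\<bar>real_of_int r - 4 * (c - \<alpha>)\<bar> \<le> 1/2"
    unfolding r_def by (rule of_int_round_abs_le)
  show "real_of_int (r mod 4) / 4 \<in> quarters"
    by (rule imageI) simp
  fix y assume "y \<in> near_mod1 (1/8) (real_of_int (r mod 4) / 4)"
  then obtain m where m: "\<bar>y - real_of_int (r mod 4) / 4 - real_of_int m\<bar> < 1/8"
    by (auto simp: near_mod1_def)
  \<comment> \<open>Here \<open>q\<close> and \<open>w\<close> stand for the quotient and remainder
    of \<open>r\<close> modulo 4; the quotient is a whole number of turns and is absorbed into the
    integer \<open>m\<close>.\<close>
  have arith: "\<bar>y + \<alpha> - c - (m' - q)\<bar> < 1/4"
    if "\<bar>y - w / 4 - m'\<bar> < 1/8" "\<bar>r' - 4 * (c - \<alpha>)\<bar> \<le> 1/2" "r' = 4 * q + w" for w m' r' q :: real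
    using that unfolding abs_less_iff abs_le_iff by argo
  have "real_of_int r = 4 * real_of_int (r div 4) + real_of_int (r mod 4)"
    by (metis mult_div_mod_eq of_int_add of_int_mult of_int_numeral)
  with arith[OF m r] have "\<bar>y + \<alpha> - c - real_of_int (m - r div 4)\<bar> < 1/4"
    by simp
  then show "y + \<alpha> \<in> near_mod1 (1/4) c"
    unfolding near_mod1_def by blast
qed

text \<open>Each pair of a set \<open>X\<close> and a target \<open>t\<close> gets a condensation
  point of \<open>X\<close>, all of them rationally independent. Kronecker's theorem yields one
  \<open>u\<close> that moves every such point close to its target. The condition is open, so it
  holds at uncountably many points of \<open>X\<close> near the condensation point.\<close>

lemma equidistributing_frequency:
  fixes V :: "real set set" and T :: "real set"
  assumes "finite V" "\<And>X. X \<in> V \<Longrightarrow> uncountable X" "finite T" "\<epsilon> > 0"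
  shows "\<exists>u. \<forall>X\<in>V. \<forall>t\<in>T. uncountable {s \<in> X. u * s \<in> near_mod1 \<epsilon> t}"
proof -
  \<comment> \<open>Enumerating the pairs gives each pair its own point, even when several pairs
    share the same \<open>X\<close>.\<close>
  obtain h where h: "bij_betw h {0..<card (V \<times> T)} (V \<times> T)"
    using ex_bij_betw_nat_finite[of "V \<times> T"] assms by auto
  define N where "N = card (V \<times> T)"
  have hV: "h i \<in> V \<times> T" if "i < N" for i
    using bij_betwE[OF h] that by (simp add: N_def)
  define C where "C i = {x \<in> fst (h i). \<forall>U. open U \<longrightarrow> x \<in> U \<longrightarrow> uncountable (fst (h i) \<inter> U)}" for i
  have "uncountable (C i)" if "i < N" for i
    unfolding C_def using hV[OF that] assms(2) by (intro uncountable_condensation_points) auto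
  then obtain \<theta> where \<theta>: "\<forall>i<N. \<theta> i \<in> C i" "inj_on \<theta> {..<N}"
      "\<not> module.dependent (\<lambda>r x. of_rat r * x) (\<theta> ` {..<N})"
    using rat_independent_selection[of N C] by blast
  obtain u m where u: "\<And>i. i < N \<Longrightarrow> \<bar>u * \<theta> i - of_int (m i) - snd (h i)\<bar> < \<epsilon>"
    using Kronecker_thm_1[OF rat_independent_imp_int_independent[OF \<theta>(3)] \<theta>(2) assms(4), of "\<lambda>i. snd (h i)"] by blast
  have "uncountable {s \<in> X. u * s \<in> near_mod1 \<epsilon> t}" if "X \<in> V" "t \<in> T" for X t
  proof -
    have "(X, t) \<in> h ` {0..<N}"
      using h that by (auto simp: N_def bij_betw_def)
    then obtain i where i: "i < N" "h i = (X, t)"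
      by (metis atLeastLessThan_iff imageE)
    have "u * \<theta> i \<in> near_mod1 \<epsilon> t"
      using u[OF i(1)] i(2) by (auto simp: near_mod1_def algebra_simps)
    then have "uncountable (X \<inter> {y. u * y \<in> near_mod1 \<epsilon> t})"
      using \<theta>(1) i open_scaled_near_mod1[of u \<epsilon> t] by (auto simp: C_def)
    then show ?thesis
      by (simp add: Int_def)
  qed
  then show ?thesis
    by blast
qed

text \<open>The order of quantifiers matters: the sequence \<open>u\<close> is fixed before
  \<open>c\<close>, \<open>x\<close> and \<open>j\<close>. The frequencies are found along a
  finitely branching tree of uncountable subsets of \<open>K\<close>; \<open>c\<close> and
  \<open>x\<close> only determine which branch is followed.\<close>

lemma simultaneous_frequencies:
  fixes K :: "real set"
  assumes "uncountable K"
  obtains u :: "nat \<Rightarrow> real" where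
    "\<And>c x j. \<exists>s\<in>K. \<forall>i<j. u i * (s + x) \<in> near_mod1 (1/4) (c i)"
proof -
  \<comment> \<open>The members of V j are uncountable subsets of K, one for each j-tuple of quarters.\<close>
  define g where "g V = (SOME u. \<forall>X\<in>V. \<forall>t\<in>quarters. uncountable {s \<in> X. u * s \<in> near_mod1 (1/8) t})" for V
  \<comment> \<open>A single frequency \<open>g V\<close> serves the whole generation
    \<open>V\<close>, and every member branches once for each quarter.\<close>
  define step where "step V = (\<lambda>(X, t). {s \<in> X. g V * s \<in> near_mod1 (1/8) t}) ` (V \<times> quarters)" for V
  define V where "V j = (step ^^ j) {K}" for j
  have V_Suc: "V (Suc j) = step (V j)" for j
    by (simp add: V_def)
  have V: "finite (V j) \<and> (\<forall>X\<in>V j. uncountable X)" for j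
  proof (induction j)
    case 0
    then show ?case
      using assms by (simp add: V_def)
  next
    case (Suc j)
    have "\<exists>u. \<forall>X\<in>V j. \<forall>t\<in>quarters. uncountable {s \<in> X. u * s \<in> near_mod1 (1/8) t}"
      using Suc by (intro equidistributing_frequency) auto
    then have "\<forall>X\<in>V j. \<forall>t\<in>quarters. uncountable {s \<in> X. g (V j) * s \<in> near_mod1 (1/8) t}"
      unfolding g_def by (rule someI_ex)
    then show ?case
      using Suc by (auto simp: V_Suc step_def)
  qed
  have cell: "\<exists>X\<in>V j. \<forall>s\<in>X. s \<in> K \<and> (\<forall>i<j. g (V i) * (s + x) \<in> near_mod1 (1/4) (c i))" for c x j
  proof (induction j)
    case 0
    then show ?case by (simp add: V_def)
  next
    case (Suc j)
    then obtain X where X: "X \<in> V j" "\<forall>s\<in>X. s \<in> K \<and> (\<forall>i<j. g (V i) * (s + x) \<in> near_mod1 (1/4) (c i))"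
      by blast
    \<comment> \<open>The quarter \<open>t\<close> approximates \<open>c j - g (V j) * x\<close>
      modulo 1 and selects the branch at level \<open>j\<close>.\<close>
    obtain t where t: "t \<in> quarters"
        "\<And>y. y \<in> near_mod1 (1/8) t \<Longrightarrow> y + g (V j) * x \<in> near_mod1 (1/4) (c j)"
      using quarter_translate[of "g (V j) * x" "c j"] by blast
    let ?Y = "{s \<in> X. g (V j) * s \<in> near_mod1 (1/8) t}"
    have "?Y \<in> V (Suc j)"
      unfolding V_Suc step_def using X(1) t(1) by (intro image_eqI[of _ _ "(X, t)"]) auto
    moreover have "\<forall>s\<in>?Y. s \<in> K \<and> (\<forall>i<Suc j. g (V i) * (s + x) \<in> near_mod1 (1/4) (c i))"
      using X(2) t(2) by (auto simp: less_Suc_eq distrib_left)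
    ultimately show ?case
      by blast
  qed
  show ?thesis
  proof
    fix c :: "nat \<Rightarrow> real" and x j
    obtain X where X: "X \<in> V j" "\<forall>s\<in>X. s \<in> K \<and> (\<forall>i<j. g (V i) * (s + x) \<in> near_mod1 (1/4) (c i))"
      using cell by blast
    moreover have "X \<noteq> {}"
      using V X(1) by auto
    ultimately show "\<exists>s\<in>K. \<forall>i<j. g (V i) * (s + x) \<in> near_mod1 (1/4) (c i)"
      by blast
  qed
qed

section \<open>Open partitions on the real line\<close>

lemma open_domatic_real_uncountable:
  fixes K :: "real set"
  assumes "uncountable K"
  shows "\<exists>E :: nat \<Rightarrow> real set. (\<forall>j. open (E j)) \<and> disjoint_family E \<and> (\<forall>x j. \<exists>s\<in>K. s + x \<in> E j)"
proof -
  obtain u :: "nat \<Rightarrow> real" where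
    u: "\<And>c x j. \<exists>s\<in>K. \<forall>i<j. u i * (s + x) \<in> near_mod1 (1/4) (c i)"
    using simultaneous_frequencies[OF assms] by blast
  \<comment> \<open>In the part \<open>E j\<close>, the index \<open>j\<close> is the first one
    whose arc is (1/2,1). For \<open>i < j\<close> the parts \<open>E i\<close> and
    \<open>E j\<close> therefore require opposite arcs at frequency \<open>i\<close>.\<close>
  define c :: "nat \<Rightarrow> nat \<Rightarrow> real" where "c j i = (if i < j then 1/4 else 3/4)" for j i
  define E where "E j = (\<Inter>i\<in>{..j}. {y. u i * y \<in> near_mod1 (1/4) (c j i)})" for j
  have "open (E j)" for j
    unfolding E_def by (intro open_INT) (auto intro: open_scaled_near_mod1)
  moreover have "E i \<inter> E j = {}" if "i < j" for i j
  proof -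
    have "E i \<subseteq> {y. u i * y \<in> near_mod1 (1/4) (3/4)}" "E j \<subseteq> {y. u i * y \<in> near_mod1 (1/4) (1/4)}"
      using that by (auto simp: E_def c_def split: if_splits)
    then show ?thesis
      using near_mod1_disjoint by blast
  qed
  then have "disjoint_family E"
    unfolding disjoint_family_on_def by (metis Int_commute linorder_neqE_nat)
  moreover have "\<exists>s\<in>K. s + x \<in> E j" for x j
    \<comment> \<open>The part \<open>E j\<close> constrains the indices up to and including
      \<open>j\<close>, hence \<open>Suc j\<close>.\<close>
    using u[of "Suc j" x "c j"] by (auto simp: E_def less_Suc_eq_le)
  ultimately show ?thesis
    by blast
qed

text \<open>The gaps make the balls of radius \<open>k\<close> about \<open>a k\<close> pairwise
  disjoint. The increment 2k + 1 is the sum of the consecutive radii k and k + 1.\<close>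

lemma sparse_sequence:
  fixes A :: "real set"
  assumes "\<And>B. \<exists>a\<in>A. \<bar>a\<bar> > B"
  obtains a :: "nat \<Rightarrow> real" where "\<And>k. a k \<in> A" "\<And>i k. i < k \<Longrightarrow> \<bar>a k\<bar> > \<bar>a i\<bar> + i + k"
proof -
  have "\<exists>a. \<forall>k. (a k \<in> A) \<and> \<bar>a (Suc k)\<bar> > \<bar>a k\<bar> + 2 * k + 1"
    using assms by (intro dependent_nat_choice) (auto simp: add.assoc)
  then obtain a :: "nat \<Rightarrow> real" where a: "\<And>k. a k \<in> A" "\<And>k. \<bar>a (Suc k)\<bar> > \<bar>a k\<bar> + 2 * k + 1"
    by blast
  have "\<bar>a k\<bar> > \<bar>a i\<bar> + i + k" if "i < k" for i k
    using that
  proof (induction k)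
    case (Suc k)
    then show ?case
      using a(2)[of k] by (cases "i = k") auto
  qed simp
  with a(1) show ?thesis
    using that by blast
qed

lemma open_domatic_real_unbounded:
  fixes A :: "real set"
  assumes "\<And>B. \<exists>a\<in>A. \<bar>a\<bar> > B"
  shows "\<exists>E :: nat \<Rightarrow> real set. (\<forall>j. open (E j)) \<and> disjoint_family E \<and> (\<forall>x j. \<exists>s\<in>A. s + x \<in> E j)"
proof -
  obtain a :: "nat \<Rightarrow> real" where a: "\<And>k. a k \<in> A" "\<And>i k. i < k \<Longrightarrow> \<bar>a k\<bar> > \<bar>a i\<bar> + i + k"
    using sparse_sequence assms by blast
  \<comment> \<open>The pairing function deals the disjoint balls out to the parts, so that each
    part receives balls of arbitrarily large radius. A ball of radius above \<bar>x\<bar> contains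
    its centre shifted by \<open>x\<close>.\<close>
  define E where "E j = (\<Union>i. ball (a (prod_encode (j, i))) (prod_encode (j, i)))" for j
  have disj: "ball (a i) i \<inter> ball (a k) k = {}" if "i \<noteq> k" for i k :: nat
  proof -
    have "\<bar>a i - a k\<bar> \<ge> i + k"
      using that a(2)[of i k] a(2)[of k i] by (cases "i < k") auto
    then show ?thesis
      by (auto simp: dist_real_def)
  qed
  have "disjoint_family E"
    unfolding disjoint_family_on_def
  proof safe
    fix m n :: nat and y assume "m \<noteq> n" "y \<in> E m" "y \<in> E n"
    then obtain i k where "y \<in> ball (a (prod_encode (m, i))) (prod_encode (m, i))"
        "y \<in> ball (a (prod_encode (n, k))) (prod_encode (n, k))"
      by (auto simp: E_def)
    with disj[of "prod_encode (m, i)" "prod_encode (n, k)"] \<open>m \<noteq> n\<close> show "y \<in> {}"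
      by (auto simp: prod_encode_eq)
  qed
  moreover have "\<exists>s\<in>A. s + x \<in> E j" for x j
  proof -
    obtain i :: nat where "real i > \<bar>x\<bar>"
      using reals_Archimedean2 by blast
    then have "real (prod_encode (j, i)) > \<bar>x\<bar>"
      using le_prod_encode_2[of i j] by linarith
    then have "a (prod_encode (j, i)) + x \<in> E j"
      unfolding E_def by (intro UN_I[of i]) (simp_all add: dist_real_def)
    then show ?thesis
      using a(1) by blast
  qed
  moreover have "\<forall>j. open (E j)"
    by (auto simp: E_def)
  ultimately show ?thesis
    by blast
qed

section \<open>From the real line to R^n\<close>

lemma domatic_partition_Sch:
  "domatic_partition (Sch n S) D \<longleftrightarrow>
     (\<forall>j. D j \<subseteq> Rn n) \<and> disjoint_family D \<and> (\<forall>x\<in>Rn n. \<forall>j. \<exists>s\<in>S. (\<lambda>i. s i + x i) \<in> D j)"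
proof -
  have "parcs (Sch n S) `` {x} \<inter> D j \<noteq> {} \<longleftrightarrow> (\<exists>s\<in>S. (\<lambda>i. s i + x i) \<in> D j)" if "x \<in> Rn n" for x j
    using that by (auto simp: Sch_def)
  then show ?thesis
    unfolding domatic_partition_def by (simp add: Sch_def)
qed

lemma continuous_map_Euclidean_space_coordinate:
  "continuous_map (Euclidean_space n) euclideanreal (\<lambda>x. x i)"
  unfolding Euclidean_space_def
  by (intro continuous_map_from_subtopology continuous_map_product_coordinates) auto

lemma continuous_map_Euclidean_space_translation:
  assumes "a \<in> Rn n"
  shows "continuous_map (Euclidean_space n) (Euclidean_space n) (\<lambda>x i. a i + x i)"
    and "continuous_map (Euclidean_space n) (Euclidean_space n) (\<lambda>x i. x i + a i)"
    and "continuous_map (Euclidean_space n) (Euclidean_space n) (\<lambda>x i. x i - a i)"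
proof -
  have "continuous_map (Euclidean_space n) (Euclidean_space n) (\<lambda>x. x)" "continuous_map (Euclidean_space n) (Euclidean_space n) (\<lambda>x. a)"
    using assms by (simp_all add: continuous_map_id[unfolded id_def])
  then show "continuous_map (Euclidean_space n) (Euclidean_space n) (\<lambda>x i. a i + x i)"
    and "continuous_map (Euclidean_space n) (Euclidean_space n) (\<lambda>x i. x i + a i)"
    and "continuous_map (Euclidean_space n) (Euclidean_space n) (\<lambda>x i. x i - a i)"
    by (simp_all add: continuous_map_Euclidean_space_add continuous_map_Euclidean_space_diff)
qed

text \<open>Coordinates are additive and continuous, so preimages of the sets \<open>E j\<close>
  under the coordinate \<open>i\<close> inherit openness, disjointness and the meeting
  property.\<close>

lemma open_domatic_partition_coordinate:
  fixes E :: "nat \<Rightarrow> real set"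
  assumes E: "\<And>j. open (E j)" "disjoint_family E"
    and meet: "\<And>x j. \<exists>s\<in>S. s i + x \<in> E j"
    and S: "S \<subseteq> Rn n"
  shows "\<exists>D. domatic_partition (Sch n S) D \<and> (\<forall>j. openin (Euclidean_space n) (D j))"
proof (intro exI conjI allI)
  define D where "D j = {y \<in> Rn n. y i \<in> E j}" for j
  show "openin (Euclidean_space n) (D j)" for j
    unfolding D_def
    by (rule openin_continuous_map_preimage[OF continuous_map_Euclidean_space_coordinate]) (use E in simp)
  show "domatic_partition (Sch n S) D"
    unfolding domatic_partition_Sch
  proof (intro conjI ballI allI)
    show "disjoint_family D"
      using E(2) by (fastforce simp: disjoint_family_on_def D_def)
    fix x j assume x: "x \<in> Rn n"
    obtain s where s: "s \<in> S" "s i + x i \<in> E j"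
      using meet by blast
    then have "(\<lambda>i. s i + x i) \<in> D j"
      using x S by (auto simp: D_def topspace_Euclidean_space)
    with s(1) show "\<exists>s\<in>S. (\<lambda>i. s i + x i) \<in> D j"
      by blast
  qed (auto simp: D_def)
qed

text \<open>The Euclidean distance dominates each coordinate difference and is at most the sum of
  their absolute values.\<close>

lemma Rn_bounded_iff_coordinates:
  assumes "S \<subseteq> Rn n"
  shows "Rn_bounded n S \<longleftrightarrow> (\<exists>B. \<forall>s\<in>S. \<forall>i<n. \<bar>s i\<bar> \<le> B)"
proof -
  interpret Metric_space "Rn n" "euclid_dist n"
    by (rule Metric_space_euclid_dist)
  have "(\<exists>B. \<forall>x\<in>S. \<forall>y\<in>S. euclid_dist n x y \<le> B) \<longleftrightarrow> (\<exists>B. \<forall>s\<in>S. \<forall>i<n. \<bar>s i\<bar> \<le> B)"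
  proof safe
    fix B assume B: "\<forall>x\<in>S. \<forall>y\<in>S. euclid_dist n x y \<le> B"
    show "\<exists>B. \<forall>s\<in>S. \<forall>i<n. \<bar>s i\<bar> \<le> B"
    proof (cases "S = {}")
      case False
      then obtain a where a: "a \<in> S"
        by blast
      have "\<bar>s i\<bar> \<le> (\<Sum>i<n. \<bar>a i\<bar>) + B" if "s \<in> S" "i < n" for s i
      proof -
        have "\<bar>s i - a i\<bar> \<le> L2_set (\<lambda>i. \<bar>s i - a i\<bar>) {..<n}"
          using that(2) by (intro member_le_L2_set) auto
        also have "\<dots> = euclid_dist n s a"
          by (simp add: euclid_dist_def L2_set_def)
        also have "\<dots> \<le> B"
          using B a that(1) by blast
        finally have "\<bar>s i - a i\<bar> \<le> B" .
        moreover have "\<bar>a i\<bar> \<le> (\<Sum>i<n. \<bar>a i\<bar>)"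
          using that(2) by (intro member_le_sum) auto
        ultimately show ?thesis
          by linarith
      qed
      then show ?thesis
        by blast
    qed simp
  next
    fix B assume B: "\<forall>s\<in>S. \<forall>i<n. \<bar>s i\<bar> \<le> B"
    have "euclid_dist n x y \<le> (\<Sum>i<n. 2 * B)" if "x \<in> S" "y \<in> S" for x y
    proof -
      have "euclid_dist n x y \<le> (\<Sum>i<n. \<bar>x i - y i\<bar>)"
        unfolding euclid_dist_def by (rule L2_set_le_sum_abs)
      also have "\<dots> \<le> (\<Sum>i<n. 2 * B)"
      proof (rule sum_mono)
        fix i assume "i \<in> {..<n}"
        then have "\<bar>x i\<bar> \<le> B" "\<bar>y i\<bar> \<le> B"
          using B that by auto
        then show "\<bar>x i - y i\<bar> \<le> 2 * B"
          by linarith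
      qed
      finally show ?thesis .
    qed
    then show "\<exists>B. \<forall>x\<in>S. \<forall>y\<in>S. euclid_dist n x y \<le> B"
      by blast
  qed
  then show ?thesis
    using assms by (simp add: Rn_bounded_def mbounded_alt)
qed

lemma compactin_closure_of_Rn_bounded:
  assumes "S \<subseteq> Rn n" "Rn_bounded n S"
  shows "compactin (Euclidean_space n) (Euclidean_space n closure_of S)"
proof -
  obtain B where B: "\<forall>s\<in>S. \<forall>i<n. \<bar>s i\<bar> \<le> B"
    using assms Rn_bounded_iff_coordinates by blast
  \<comment> \<open>The box is formed in the full product, with factor {0} from index
    \<open>n\<close> on, so that Tychonoff's theorem applies before passing to the subspace.\<close>
  define Q where "Q = (\<Pi>\<^sub>E i\<in>UNIV. if i < n then {-B..B} else {0::real})"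
  have "compactin (powertop_real UNIV) Q"
    unfolding Q_def compactin_PiE by auto
  moreover have "Q \<subseteq> {x. \<forall>i\<ge>n. x i = 0}"
    by (auto simp: Q_def PiE_iff) (metis (full_types) leD singletonD)
  ultimately have Q: "compactin (Euclidean_space n) Q"
    by (simp add: Euclidean_space_def compactin_subtopology)
  then have "closedin (Euclidean_space n) Q"
    by (intro compactin_imp_closedin metrizable_imp_Hausdorff_space metrizable_Euclidean_space)
  moreover have "S \<subseteq> Q"
  proof
    fix s assume "s \<in> S"
    then have "s i = 0" if "\<not> i < n" for i
      using assms(1) that by (auto simp: topspace_Euclidean_space)
    moreover have "s i \<in> {-B..B}" if "i < n" for i
    proof -
      have "\<bar>s i\<bar> \<le> B"
        using B \<open>s \<in> S\<close> that by blast
      then show ?thesis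
        by (simp add: abs_le_iff)
    qed
    ultimately show "s \<in> Q"
      by (auto simp: Q_def PiE_iff)
  qed
  ultimately have "Euclidean_space n closure_of S \<subseteq> Q"
    by (rule closure_of_minimal[rotated])
  then show ?thesis
    using Q closed_compactin closedin_closure_of by blast
qed

text \<open>Otherwise \<open>C\<close> would embed into a finite product of countable sets;
  restriction to the first \<open>n\<close> indices is injective because all later coordinates
  vanish.\<close>

lemma uncountable_coordinate_projection:
  assumes "C \<subseteq> Rn n" "uncountable C"
  shows "\<exists>i<n. uncountable ((\<lambda>s. s i) ` C)"
proof (rule ccontr)
  assume "\<not> ?thesis"
  then have "countable (\<Pi>\<^sub>E i\<in>{..<n}. (\<lambda>s. s i) ` C)"
    by (intro countable_PiE) auto
  moreover have "(\<lambda>s. restrict s {..<n}) ` C \<subseteq> (\<Pi>\<^sub>E i\<in>{..<n}. (\<lambda>s. s i) ` C)"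
    by (intro image_subsetI PiE_I) auto
  ultimately have "countable ((\<lambda>s. restrict s {..<n}) ` C)"
    by (rule countable_subset[rotated])
  moreover have "inj_on (\<lambda>s. restrict s {..<n}) C"
  proof (rule inj_onI, rule ext)
    fix s t i assume st: "s \<in> C" "t \<in> C" "restrict s {..<n} = restrict t {..<n}"
    show "s i = t i"
    proof (cases "i < n")
      case True
      then show ?thesis
        using fun_cong[OF st(3), of i] by simp
    next
      case False
      moreover have "s \<in> Rn n" "t \<in> Rn n"
        using st(1,2) assms(1) by blast+
      ultimately show ?thesis
        by (simp add: topspace_Euclidean_space)
    qed
  qed
  ultimately show False
    using assms(2) countable_image_inj_on by blast
qed

text \<open>The real-line construction is applied to a projection of the closure, which only gives
  witnesses in the closure. Since the parts are open, a witness can be moved to a nearby point of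
  \<open>S\<close>.\<close>

lemma open_domatic_partition_of_uncountable_closure:
  assumes S: "S \<subseteq> Rn n" and unc: "uncountable (Euclidean_space n closure_of S)"
  shows "\<exists>D. domatic_partition (Sch n S) D \<and> (\<forall>j. openin (Euclidean_space n) (D j))"
proof -
  obtain i where i: "uncountable ((\<lambda>s. s i) ` (Euclidean_space n closure_of S))"
    using uncountable_coordinate_projection[OF closure_of_subset_topspace unc] by blast
  obtain E :: "nat \<Rightarrow> real set" where E: "\<And>j. open (E j)" "disjoint_family E"
      "\<And>x j. \<exists>s\<in>(\<lambda>s. s i) ` (Euclidean_space n closure_of S). s + x \<in> E j"
    using open_domatic_real_uncountable[OF i] by blast
  have "\<exists>s\<in>S. s i + x \<in> E j" for x j
  proof -
    obtain c where c: "c \<in> Euclidean_space n closure_of S" "c i + x \<in> E j"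
      using E(3) by blast
    define V where "V = (\<lambda>y. y + x) -` E j"
    have "open V"
      unfolding V_def by (rule open_vimage[OF E(1)]) (intro continuous_intros)
    then have V: "openin (Euclidean_space n) {y \<in> Rn n. y i \<in> V}"
      by (intro openin_continuous_map_preimage[OF continuous_map_Euclidean_space_coordinate]) simp
    have "c \<in> Rn n"
      using subsetD[OF closure_of_subset_topspace c(1)] .
    then have "c \<in> {y \<in> Rn n. y i \<in> V}"
      using c(2) by (simp add: V_def)
    then obtain s where "s \<in> S" "s \<in> {y \<in> Rn n. y i \<in> V}"
      using iffD1[OF in_closure_of c(1)] V by meson
    then show ?thesis
      by (auto simp: V_def)
  qed
  then show ?thesis
    using open_domatic_partition_coordinate[OF E(1,2) _ S] by blast
qed

lemma open_domatic_partition_of_unbounded: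
  assumes S: "S \<subseteq> Rn n" and unb: "\<not> Rn_bounded n S"
  shows "\<exists>D. domatic_partition (Sch n S) D \<and> (\<forall>j. openin (Euclidean_space n) (D j))"
proof -
  have "\<exists>i. \<forall>B. \<exists>s\<in>S. \<bar>s i\<bar> > B"
  proof (rule ccontr)
    assume "\<not> ?thesis"
    then obtain b where b: "\<And>i s. s \<in> S \<Longrightarrow> \<bar>s i\<bar> \<le> b i"
      by (metis not_le)
    \<comment> \<open>Finitely many coordinates matter, so separate bounds combine into a common
      one.\<close>
    have "\<bar>s i\<bar> \<le> (\<Sum>i<n. \<bar>b i\<bar>)" if "s \<in> S" "i < n" for s i
    proof -
      have "\<bar>b i\<bar> \<le> (\<Sum>i<n. \<bar>b i\<bar>)"
        using that(2) by (intro member_le_sum) auto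
      with b[OF that(1), of i] show ?thesis
        by linarith
    qed
    then show False
      using unb Rn_bounded_iff_coordinates[OF S] by blast
  qed
  then obtain i where "\<And>B. \<exists>a\<in>(\<lambda>s. s i) ` S. \<bar>a\<bar> > B"
    by auto
  from open_domatic_real_unbounded[OF this]
  obtain E :: "nat \<Rightarrow> real set" where E: "\<And>j. open (E j)" "disjoint_family E"
      "\<And>x j. \<exists>s\<in>(\<lambda>s. s i) ` S. s + x \<in> E j"
    by blast
  show ?thesis
    using E(3) by (intro open_domatic_partition_coordinate[OF E(1,2) _ S, of i]) auto
qed

section \<open>Baire category and the obstruction for small S\<close>

lemma nowhere_dense_in_empty: "nowhere_dense_in X {}"
  by (simp add: nowhere_dense_in_def)

lemma openin_imp_Baire_measurable_in:
  assumes "openin X U"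
  shows "Baire_measurable_in X U"
  unfolding Baire_measurable_in_def meager_in_def
  using assms openin_subset nowhere_dense_in_empty
  by (intro conjI exI[of _ U] exI[of _ "\<lambda>_. {}"]) auto

text \<open>The interior of the frontier is an open set missing \<open>U\<close>, hence missing the
  closure of \<open>U\<close>, which contains it.\<close>

lemma nowhere_dense_in_frontier_of_openin:
  assumes "openin X U"
  shows "nowhere_dense_in X (X frontier_of U)"
proof -
  let ?V = "X interior_of (X frontier_of U)"
  have "?V \<subseteq> X closure_of U - U"
    using interior_of_subset[of X "X frontier_of U"] frontier_of_openin[OF assms] by simp
  moreover from this have "?V \<inter> X closure_of U = {}"
    by (subst openin_Int_closure_of_eq_empty) auto
  ultimately have "?V = {}"
    by blast
  then show ?thesis
    by (simp add: nowhere_dense_in_def closure_of_closedin closedin_frontier_of frontier_of_subset_topspace)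
qed

text \<open>For fixed \<open>s\<close> and \<open>N\<close> the bad \<open>x\<close> lie in a
  translate of the closure of \<open>N\<close>, a closed set with empty interior. There are
  countably many such pairs, so the Baire category theorem leaves a good \<open>x\<close>.\<close>

lemma exists_translate_avoiding_nowhere_dense:
  assumes K: "countable K" "K \<subseteq> Rn n"
    and N: "countable \<N>" "\<And>N. N \<in> \<N> \<Longrightarrow> nowhere_dense_in (Euclidean_space n) N"
  shows "\<exists>x\<in>Rn n. \<forall>s\<in>K. \<forall>N\<in>\<N>. (\<lambda>i. s i + x i) \<notin> N"
proof -
  let ?X = "Euclidean_space n"
  define T where "T s N = {x \<in> Rn n. (\<lambda>i. s i + x i) \<in> ?X closure_of N}" for s N
  have T: "closedin ?X (T s N) \<and> ?X interior_of (T s N) = {}" if s: "s \<in> K" and N': "N \<in> \<N>" for s N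
  proof
    have sX: "s \<in> Rn n"
      using K(2) s by blast
    show "closedin ?X (T s N)"
      unfolding T_def
      by (rule closedin_continuous_map_preimage[OF continuous_map_Euclidean_space_translation(1)[OF sX]]) simp
    \<comment> \<open>Translating the interior of \<open>T s N\<close> by \<open>s\<close> gives an
      open subset of the closure of \<open>N\<close>, which must be empty.\<close>
    define W where "W = {y \<in> Rn n. (\<lambda>i. y i - s i) \<in> ?X interior_of (T s N)}"
    have "openin ?X W"
      unfolding W_def
      by (rule openin_continuous_map_preimage[OF continuous_map_Euclidean_space_translation(3)[OF sX]]) simp
    moreover have "W \<subseteq> ?X closure_of N"
    proof
      fix y assume "y \<in> W"
      then have "(\<lambda>i. y i - s i) \<in> T s N"
        using interior_of_subset[of ?X "T s N"] by (auto simp: W_def)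
      then show "y \<in> ?X closure_of N"
        by (simp add: T_def)
    qed
    ultimately have "W = {}"
      using N(2)[OF N'] interior_of_maximal unfolding nowhere_dense_in_def by blast
    moreover have "(\<lambda>i. x i + s i) \<in> W" if "x \<in> ?X interior_of (T s N)" for x
    proof -
      have "x \<in> Rn n"
        using subsetD[OF interior_of_subset_topspace that] .
      then show ?thesis
        using that sX by (simp add: W_def topspace_Euclidean_space)
    qed
    ultimately show "?X interior_of (T s N) = {}"
      by blast
  qed
  have "?X interior_of \<Union>((\<lambda>(s, N). T s N) ` (K \<times> \<N>)) = {}"
    using T K(1) N(1)
    by (intro Baire_category_alt disjI1 completely_metrizable_Euclidean_space) auto
  moreover have "?X interior_of Rn n \<noteq> {}"
    using nontrivial_Euclidean_space[of n] by simp
  ultimately have "\<not> Rn n \<subseteq> \<Union>((\<lambda>(s, N). T s N) ` (K \<times> \<N>))"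
    using interior_of_mono by blast
  then obtain x where x: "x \<in> Rn n" "x \<notin> \<Union>((\<lambda>(s, N). T s N) ` (K \<times> \<N>))"
    by (meson subsetI)
  have "(\<lambda>i. s i + x i) \<notin> N" if "s \<in> K" "N \<in> \<N>" for s N
  proof
    assume "(\<lambda>i. s i + x i) \<in> N"
    then have "(\<lambda>i. s i + x i) \<in> ?X closure_of N"
      using closure_of_subset N(2)[OF that(2)] unfolding nowhere_dense_in_def by blast
    then have "x \<in> T s N"
      using x(1) by (simp add: T_def)
    with x(2) that show False
      by auto
  qed
  with x(1) show ?thesis
    by blast
qed

lemma no_Baire_domatic_partition:
  assumes S: "S \<subseteq> Rn n" "Rn_bounded n S" "countable (Euclidean_space n closure_of S)"
    and D: "domatic_partition (Sch n S) D" "\<And>j. Baire_measurable_in (Euclidean_space n) (D j)"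
  shows False
proof -
  let ?X = "Euclidean_space n"
  define K where "K = ?X closure_of S"
  obtain U where U: "\<And>j. openin ?X (U j)" and "\<And>j. meager_in ?X (sym_diff (D j) (U j))"
    using D(2) unfolding Baire_measurable_in_def by metis
  then obtain N where N: "\<And>j k::nat. nowhere_dense_in ?X (N j k)"
      "\<And>j. sym_diff (D j) (U j) = (\<Union>k. N j k)"
    unfolding meager_in_def by metis
  define G where "G = (\<Union>j. U j)"
  have G: "openin ?X G"
    using U by (auto simp: G_def)
  \<comment> \<open>The frontier of \<open>G\<close> is included so that the translate of
    \<open>K\<close> splits between \<open>G\<close> and its exterior.\<close>
  define \<N> where "\<N> = insert (?X frontier_of G) (range (\<lambda>(j, k). N j k))"
  have "countable \<N>"
    by (simp add: \<N>_def)
  moreover have "nowhere_dense_in ?X M" if "M \<in> \<N>" for M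
    using that N(1) nowhere_dense_in_frontier_of_openin[OF G] by (auto simp: \<N>_def)
  ultimately obtain x where x: "x \<in> Rn n" "\<And>s M. s \<in> K \<Longrightarrow> M \<in> \<N> \<Longrightarrow> (\<lambda>i. s i + x i) \<notin> M"
    using exists_translate_avoiding_nowhere_dense[of K n \<N>] S(3) closure_of_subset_topspace
    unfolding K_def by metis
  \<comment> \<open>On the translate of \<open>K\<close> by \<open>x\<close> the parts coincide with
    their open approximations.\<close>
  have DU: "(\<lambda>i. s i + x i) \<in> D j \<longleftrightarrow> (\<lambda>i. s i + x i) \<in> U j" if "s \<in> K" for s j
  proof -
    have "(\<lambda>i. s i + x i) \<notin> N j k" for k
      using x(2)[OF that, of "N j k"] by (auto simp: \<N>_def)
    then have "(\<lambda>i. s i + x i) \<notin> sym_diff (D j) (U j)"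
      unfolding N(2) by blast
    then show ?thesis
      by blast
  qed
  define K' where "K' = (\<lambda>s i. s i + x i) ` K"
  have "compactin ?X K"
    unfolding K_def by (rule compactin_closure_of_Rn_bounded[OF S(1,2)])
  then have K': "compactin ?X K'"
    unfolding K'_def
    by (rule image_compactin[OF _ continuous_map_Euclidean_space_translation(2)[OF x(1)]])
  define C where "C = Rn n - ?X closure_of G"
  have C: "openin ?X C" "C \<inter> G = {}"
    using closure_of_subset[OF openin_subset[OF G]] by (auto simp: C_def)
  have "K' \<subseteq> \<Union>(insert C (range U))"
  proof
    fix y assume "y \<in> K'"
    then have "y \<in> Rn n" "y \<notin> ?X frontier_of G"
      using compactin_subset_topspace[OF K'] x(2) by (auto simp: K'_def \<N>_def)
    then show "y \<in> \<Union>(insert C (range U))"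
      by (auto simp: C_def frontier_of_openin[OF G]) (auto simp: G_def)
  qed
  moreover have "\<forall>V\<in>insert C (range U). openin ?X V"
    using U C by blast
  ultimately obtain \<F> where \<F>: "finite \<F>" "\<F> \<subseteq> insert C (range U)" "K' \<subseteq> \<Union>\<F>"
    using K' unfolding compactin_def by meson
  have "finite (\<F> - {C})" "\<F> - {C} \<subseteq> range U"
    using \<F>(1,2) by auto
  then obtain J where J: "finite J" "\<F> - {C} = U ` J"
    by (meson finite_subset_image)
  \<comment> \<open>The part \<open>D j\<close> is met at a point of \<open>G\<close>, which the
    finite subcover places in some \<open>U i\<close> with \<open>i \<in> J\<close>, hence in
    \<open>D i\<close>. As \<open>j\<close> lies outside \<open>J\<close>, this contradicts
    disjointness.\<close>
  obtain j where j: "j \<notin> J"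
    using J(1) ex_new_if_finite infinite_UNIV_nat by blast
  obtain s where s: "s \<in> S" "(\<lambda>i. s i + x i) \<in> D j"
    using D(1) x(1) unfolding domatic_partition_Sch by blast
  have sK: "s \<in> K"
    using s(1) closure_of_subset[OF S(1)] by (auto simp: K_def)
  then have "(\<lambda>i. s i + x i) \<in> G"
    using s(2) DU by (auto simp: G_def)
  moreover have "(\<lambda>i. s i + x i) \<in> \<Union>\<F>"
    using sK \<F>(3) by (auto simp: K'_def)
  ultimately have "(\<lambda>i. s i + x i) \<in> \<Union>(\<F> - {C})"
    using C(2) by blast
  then obtain i where i: "i \<in> J" "(\<lambda>i. s i + x i) \<in> U i"
    unfolding J(2) by blast
  then have "(\<lambda>i. s i + x i) \<in> D i \<inter> D j"
    using s(2) DU[OF sK] by blast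
  moreover have "disjoint_family D" "i \<noteq> j"
    using D(1) i(1) j by (auto simp: domatic_partition_def)
  then have "D i \<inter> D j = {}"
    using disjoint_family_onD[of D UNIV i j] by simp
  ultimately show False
    by blast
qed

theorem theorem1p2:
  fixes n :: nat and S :: "(nat \<Rightarrow> real) set"
  assumes "S \<subseteq> topspace (Euclidean_space n)"
  shows "((\<exists>D. domatic_partition (Sch n S) D \<and> (\<forall>j. openin (Euclidean_space n) (D j)))
            \<longleftrightarrow> (\<exists>D. domatic_partition (Sch n S) D \<and> (\<forall>j. Baire_measurable_in (Euclidean_space n) (D j))))
       \<and> ((\<exists>D. domatic_partition (Sch n S) D \<and> (\<forall>j. Baire_measurable_in (Euclidean_space n) (D j)))
            \<longleftrightarrow> (uncountable (Euclidean_space n closure_of S) \<or> \<not> Rn_bounded n S))"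
    (is "(?open \<longleftrightarrow> ?Baire) \<and> (?Baire \<longleftrightarrow> ?large)")
proof -
  have "?open \<Longrightarrow> ?Baire"
    using openin_imp_Baire_measurable_in by blast
  moreover have "?Baire \<Longrightarrow> ?large"
    using no_Baire_domatic_partition[OF assms] by blast
  moreover have "?large \<Longrightarrow> ?open"
    using open_domatic_partition_of_uncountable_closure[OF assms]
      open_domatic_partition_of_unbounded[OF assms] by blast
  ultimately show ?thesis
    by blast
qed

end
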